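(* If $X$ is a row-finite shift space, then the following are equivalent. (a) $X$ is an edge shift. (b) $X$ is a $1$-step shift space. (c) $X$ is an $M$-step shift space for some $M\in\mathbb{N}$.
   Context: Full shift: for a set $\mathcal{A}$ (alphabet, finite or infinite), let $\mathcal{A}^0=\{\vec{0}\}$ ($\vec{0}$ the empty sequence), $\Sigma_{\mathcal{A}}^{\mathrm{fin}}=\bigcup_{k=0}^\infty\mathcal{A}^k$ (blocks) and $\Sigma_{\mathcal{A}}^{\mathrm{inf}}=\mathcal{A}^{\mathbb{N}}$, $\mathbb{N}=\{1,2,\ldots\}$; $l(x)\in\{0,1,\ldots,\infty\}$ is the length. If $\mathcal{A}$ is infinite, $\Sigma_{\mathcal{A}}:=\Sigma_{\mathcal{A}}^{\mathrm{inf}}\sqcup\Sigma_{\mathcal{A}}^{\mathrm{fin}}$ with the quotient topology from the map $Q:\mathcal{A}_\infty\times\mathcal{A}_\infty\times\cdots\to\Sigma_{\mathcal{A}}$ that truncates a sequence just before the first occurrence of $\infty$, where $\mathcal{A}_\infty=\mathcal{A}\cup\{\infty\}$ is the one-point compactification of the discrete space $\mathcal{A}$ and the product has the product topology. If $\mathcal{A}$ is finite, $\Sigma_{\mathcal{A}}:=\mathcal{A}^{\mathbb{N}}$ with the product topology. The shift map $\sigma$ deletes the first entry, with $\sigma(x)=\vec 0$ when $l(x)\le 1$. A shift space over $\mathcal{A}$ is a closed set $X\subseteq\Sigma_{\mathcal{A}}$ with $\sigma(X)\subseteq X$ having the infinite-extension property: for each $x\in X$ with $l(x)<\infty$ there are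 infinitely many $a\in\mathcal{A}$ with $xay\in X$ for some $y\in\Sigma_{\mathcal{A}}$. A subblock of a sequence $x$ is a finite block $u$ with $x=yuz$ for some finite sequence $y$ and some sequence $z$; the empty block is a subblock of every sequence. $B(X)$ is the set of finite blocks occurring as subblocks of elements of $X$; $X$ is row-finite if for every $a\in\mathcal{A}$ the set $\{b\in\mathcal{A}:ab\in B(X)\}$ is finite. Conjugacy: for shift spaces $X$, $Y$ (over possibly different alphabets), a shift morphism $\phi:X\to Y$ is a continuous map with $\phi\circ\sigma=\sigma\circ\phi$ and $l(\phi(x))=l(x)$ for all $x\in X$; a conjugacy is a bijective shift morphism; $X$ and $Y$ are conjugate if a conjugacy exists. For $\mathcal{F}\subseteq\Sigma_{\mathcal{A}}^{\mathrm{fin}}$: $X^{\mathrm{inf}}_{\mathcal{F}}:=\{x\in\Sigma_{\mathcal{A}}^{\mathrm{inf}}:\text{no subblock of }x\text{ is in }\mathcal{F}\}$, $X^{\mathrm{fin}}_{\mathcal{F}}:=\{x\in\Sigma_{\mathcal{A}}^{\mathrm{fin}}:\text{there are infinitely many }a\in\mathcal{A}\text{ for which there exists }y\in\Sigma_{\mathcal{A}}^{\mathrm{inf}}\text{ with }xay\in X^{\mathrm{inf}}_{\mathcal{F}}\}$, $X_{\mathcal{F}}:=X^{\mathrm{inf}}_{\mathcal{F}}\cup X^{\mathrm{fin}}_{\mathcal{F}}$. A shift space $X$ over $\mathcal{A}$ is $M$-step ($M\in\mathbb{N}\cup\{0\}$) if $X=X_{\mathcal{F}}$ for some $\mathcal{F}\subseteq\Sigma_{\mathcal{A}}^{\mathrm{fin}}$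 all of whose elements have length $M+1$. A directed graph $E=(E^0,E^1,r,s)$ consists of a countable set $E^0$ (vertices), a countable set $E^1$ (edges), and range and source maps $r,s:E^1\to E^0$; countable means finite or countably infinite. A vertex $v$ is a sink if $s^{-1}(v)=\emptyset$. $E^\infty$ is the set of sequences $e_1e_2\ldots$ of edges with $r(e_i)=s(e_{i+1})$ for all $i$. If $E$ has no sinks, the edge shift $X_E$ of $E$ is the closure of $E^\infty$ in $\Sigma_{E^1}$. A shift space $X$ is called an edge shift if $X$ is conjugate to $X_E$ for some graph $E$ with no sinks.
   Formalization: In (b) and (c), "is an M-step shift space" is read as "is conjugate to an M-step shift space over a countable alphabet"; literally the claim fails (avoiding 111 over {0,1} is 2-step but not 1-step; constant sequences over an uncountable alphabet are 1-step but no edge shift). *)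

theory Defs
  imports
    "HOL-Analysis.Analysis"
    "HOL-Library.Extended_Nat"
    "HOL-Library.Omega_Words_Fun"
    "Graph_Theory.Digraph"
begin

section \<open>Finite and infinite sequences\<close>

text \<open>Entries of an infinite sequence are indexed from 0 rather than from 1.\<close>

datatype 'a seqn = FinSeq "'a list" | InfSeq "nat \<Rightarrow> 'a"

definition fin_seqs :: "'a set \<Rightarrow> 'a seqn set" where
  "fin_seqs A = FinSeq ` lists A"

definition inf_seqs :: "'a set \<Rightarrow> 'a seqn set" where
  "inf_seqs A = InfSeq ` {f. range f \<subseteq> A}"

fun seqn_length :: "'a seqn \<Rightarrow> enat" where
  "seqn_length (FinSeq u) = enat (length u)"
| "seqn_length (InfSeq f) = \<infinity>"

fun prepend :: "'a list \<Rightarrow> 'a seqn \<Rightarrow> 'a seqn" where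
  "prepend u (FinSeq v) = FinSeq (u @ v)"
| "prepend u (InfSeq f) = InfSeq (u \<frown> f)"

fun shift :: "'a seqn \<Rightarrow> 'a seqn" where
  "shift (FinSeq u) = FinSeq (tl u)"
| "shift (InfSeq f) = InfSeq (\<lambda>n. f (Suc n))"

section \<open>The full shift\<close>

definition quotient_topology :: "'a topology \<Rightarrow> ('a \<Rightarrow> 'b) \<Rightarrow> 'b topology" where
  "quotient_topology T q =
     topology (\<lambda>U. U \<subseteq> q ` topspace T \<and> openin T {x \<in> topspace T. q x \<in> U})"

lemma openin_quotient_topology:
  "openin (quotient_topology T q) U \<longleftrightarrow>
     U \<subseteq> q ` topspace T \<and> openin T {x \<in> topspace T. q x \<in> U}"
proof -
  let ?P = "\<lambda>U. U \<subseteq> q ` topspace T \<and> openin T {x \<in> topspace T. q x \<in> U}"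
  have "?P (U \<inter> V)" if "?P U" "?P V" for U V
  proof -
    have "{x \<in> topspace T. q x \<in> U \<inter> V} =
        {x \<in> topspace T. q x \<in> U} \<inter> {x \<in> topspace T. q x \<in> V}" by auto
    then show ?thesis using that by auto
  qed
  moreover have "?P (\<Union> K)" if "\<forall>U\<in>K. ?P U" for K
  proof -
    have "{x \<in> topspace T. q x \<in> \<Union> K} = (\<Union>U\<in>K. {x \<in> topspace T. q x \<in> U})" by auto
    then show ?thesis using that by auto
  qed
  ultimately have "istopology ?P"
    unfolding istopology_def by blast
  then show ?thesis
    by (simp add: quotient_topology_def)
qed

lemma topspace_quotient_topology [simp]:
  "topspace (quotient_topology T q) = q ` topspace T"
proof
  show "topspace (quotient_topology T q) \<subseteq> q ` topspace T"
    using openin_quotient_topology openin_topspace by metis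
  have "{x \<in> topspace T. q x \<in> q ` topspace T} = topspace T" by auto
  then have "openin (quotient_topology T q) (q ` topspace T)"
    by (simp add: openin_quotient_topology)
  then show "q ` topspace T \<subseteq> topspace (quotient_topology T q)"
    by (rule openin_subset)
qed

lemma quotient_map_quotient_topology: "quotient_map T (quotient_topology T q) q"
  by (auto simp: quotient_map_def openin_quotient_topology)

text \<open>The point \<open>\<infinity>\<close> adjoined to the alphabet is \<open>None\<close>.\<close>

definition truncate_seq :: "(nat \<Rightarrow> 'a option) \<Rightarrow> 'a seqn" where
  "truncate_seq f =
     (if \<exists>n. f n = None then FinSeq (map (\<lambda>i. the (f i)) [0..<(LEAST n. f n = None)])
      else InfSeq (\<lambda>i. the (f i)))"

text \<open>For finite \<open>A\<close>, the quotient along the injection \<open>InfSeq\<close> is just the product topology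
  carried over to \<open>inf_seqs A\<close>.\<close>

definition full_shift :: "'a set \<Rightarrow> 'a seqn topology" where
  "full_shift A =
     (if finite A
      then quotient_topology (product_topology (\<lambda>_. discrete_topology A) UNIV) InfSeq
      else quotient_topology
             (product_topology (\<lambda>_. Alexandroff_compactification (discrete_topology A)) UNIV)
             truncate_seq)"

lemma truncate_seq_eq_FinSeq_iff:
  "truncate_seq f = FinSeq u \<longleftrightarrow>
     f (length u) = None \<and> (\<forall>i<length u. f i = Some (u ! i))"
proof
  assume L: "truncate_seq f = FinSeq u"
  have ex: "\<exists>n. f n = None"
  proof (rule ccontr)
    assume "\<nexists>n. f n = None"
    with L show False unfolding truncate_seq_def by simp
  qed
  with L have u: "u = map (\<lambda>i. the (f i)) [0..<(LEAST n. f n = None)]"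
    by (simp add: truncate_seq_def)
  then have len: "length u = (LEAST n. f n = None)" by simp
  have "f (length u) = None" unfolding len using ex by (rule LeastI_ex)
  moreover have "f i = Some (u ! i)" if "i < length u" for i
  proof -
    from that have "i < (LEAST n. f n = None)" by (simp only: len)
    then have "f i \<noteq> None" by (rule not_less_Least)
    moreover have "u ! i = the (f i)" using that by (simp add: u)
    ultimately show ?thesis by simp
  qed
  ultimately show "f (length u) = None \<and> (\<forall>i<length u. f i = Some (u ! i))" by blast
next
  assume R: "f (length u) = None \<and> (\<forall>i<length u. f i = Some (u ! i))"
  have "(LEAST n. f n = None) = length u"
  proof (rule Least_equality)
    show "length u \<le> n" if "f n = None" for n
      using R that by (metis not_less option.distinct(1))
  qed (use R in blast)
  moreover have "map (\<lambda>i. the (f i)) [0..<length u] = u"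
    using R by (intro nth_equalityI) auto
  ultimately show "truncate_seq f = FinSeq u"
    using R unfolding truncate_seq_def by auto
qed

lemma truncate_seq_eq_InfSeq_iff:
  "truncate_seq f = InfSeq g \<longleftrightarrow> f = (\<lambda>i. Some (g i))"
proof
  assume L: "truncate_seq f = InfSeq g"
  have no: "\<forall>n. f n \<noteq> None"
  proof (rule ccontr)
    assume "\<not> (\<forall>n. f n \<noteq> None)"
    with L show False by (simp add: truncate_seq_def)
  qed
  with L have "g = (\<lambda>i. the (f i))" by (simp add: truncate_seq_def)
  with no show "f = (\<lambda>i. Some (g i))" by auto
next
  assume "f = (\<lambda>i. Some (g i))"
  then show "truncate_seq f = InfSeq g"
    unfolding truncate_seq_def by simp
qed

lemma topspace_full_shift:
  "topspace (full_shift A) = (if finite A then inf_seqs A else inf_seqs A \<union> fin_seqs A)"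
proof (cases "finite A")
  case True
  have "Pi (UNIV :: nat set) (\<lambda>_. A) = {f. range f \<subseteq> A}" by auto
  then have "InfSeq ` Pi UNIV (\<lambda>_. A) = inf_seqs A" by (simp only: inf_seqs_def)
  with True show ?thesis by (simp add: full_shift_def PiE_UNIV_domain)
next
  case False
  let ?P = "Pi (UNIV :: nat set) (\<lambda>_. insert None (Some ` A))"
  have "truncate_seq ` ?P = inf_seqs A \<union> fin_seqs A"
  proof (intro equalityI subsetI)
    fix x assume "x \<in> truncate_seq ` ?P"
    then obtain f where f: "f \<in> ?P" "truncate_seq f = x" by blast
    have A: "f n = Some a \<Longrightarrow> a \<in> A" for n a
    proof -
      assume "f n = Some a"
      moreover have "f n \<in> insert None (Some ` A)" using f(1) by blast
      ultimately show "a \<in> A" by auto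
    qed
    show "x \<in> inf_seqs A \<union> fin_seqs A"
    proof (cases x)
      case (FinSeq u)
      with f(2) have "\<forall>i<length u. f i = Some (u ! i)" by (simp add: truncate_seq_eq_FinSeq_iff)
      then have "\<forall>i<length u. u ! i \<in> A" using A by blast
      then have "u \<in> lists A" by (metis in_listsI in_set_conv_nth)
      then show ?thesis using FinSeq by (simp add: fin_seqs_def)
    next
      case (InfSeq g)
      then have "f = (\<lambda>i. Some (g i))" using f(2) by (simp add: truncate_seq_eq_InfSeq_iff)
      then have "range g \<subseteq> A" using A by auto
      then show ?thesis using InfSeq by (auto simp: inf_seqs_def)
    qed
  next
    fix x assume x: "x \<in> inf_seqs A \<union> fin_seqs A"
    show "x \<in> truncate_seq ` ?P"
    proof (cases x)
      case (FinSeq u)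
      with x have "set u \<subseteq> A" by (auto simp: fin_seqs_def inf_seqs_def)
      then have "(\<lambda>i. if i < length u then Some (u ! i) else None) \<in> ?P" by (auto simp: subset_iff)
      moreover have "truncate_seq (\<lambda>i. if i < length u then Some (u ! i) else None) = x"
        by (simp add: FinSeq truncate_seq_eq_FinSeq_iff)
      ultimately show ?thesis by (intro image_eqI[OF sym])
    next
      case (InfSeq g)
      with x have "range g \<subseteq> A" by (auto simp: fin_seqs_def inf_seqs_def)
      then have "(\<lambda>i. Some (g i)) \<in> ?P" by auto
      moreover have "truncate_seq (\<lambda>i. Some (g i)) = x" by (simp add: InfSeq truncate_seq_eq_InfSeq_iff)
      ultimately show ?thesis by (intro image_eqI[OF sym])
    qed
  qed
  with False show ?thesis by (simp add: full_shift_def PiE_UNIV_domain)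
qed

section \<open>Shift spaces\<close>

definition shift_space :: "'a set \<Rightarrow> 'a seqn set \<Rightarrow> bool" where
  "shift_space A X \<longleftrightarrow>
     closedin (full_shift A) X \<and> shift ` X \<subseteq> X \<and>
     (\<forall>u. FinSeq u \<in> X \<longrightarrow>
        infinite {a \<in> A. \<exists>y \<in> topspace (full_shift A). prepend (u @ [a]) y \<in> X})"

definition subblock :: "'a list \<Rightarrow> 'a seqn \<Rightarrow> bool" where
  "subblock u x \<longleftrightarrow> (\<exists>y z. x = prepend y (prepend u z))"

definition blocks :: "'a seqn set \<Rightarrow> 'a list set" where
  "blocks X = {u. \<exists>x\<in>X. subblock u x}"

definition row_finite :: "'a set \<Rightarrow> 'a seqn set \<Rightarrow> bool" where
  "row_finite A X \<longleftrightarrow> (\<forall>a\<in>A. finite {b \<in> A. [a, b] \<in> blocks X})"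

definition shift_morphism ::
  "'a set \<Rightarrow> 'a seqn set \<Rightarrow> 'b set \<Rightarrow> 'b seqn set \<Rightarrow> ('a seqn \<Rightarrow> 'b seqn) \<Rightarrow> bool" where
  "shift_morphism A X B Y \<phi> \<longleftrightarrow>
     continuous_map (subtopology (full_shift A) X) (subtopology (full_shift B) Y) \<phi> \<and>
     (\<forall>x\<in>X. \<phi> (shift x) = shift (\<phi> x)) \<and>
     (\<forall>x\<in>X. seqn_length (\<phi> x) = seqn_length x)"

definition conjugacy ::
  "'a set \<Rightarrow> 'a seqn set \<Rightarrow> 'b set \<Rightarrow> 'b seqn set \<Rightarrow> ('a seqn \<Rightarrow> 'b seqn) \<Rightarrow> bool" where
  "conjugacy A X B Y \<phi> \<longleftrightarrow> shift_morphism A X B Y \<phi> \<and> bij_betw \<phi> X Y"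

definition conjugate :: "'a set \<Rightarrow> 'a seqn set \<Rightarrow> 'b set \<Rightarrow> 'b seqn set \<Rightarrow> bool" where
  "conjugate A X B Y \<longleftrightarrow> (\<exists>\<phi>. conjugacy A X B Y \<phi>)"

definition avoiding_inf :: "'a set \<Rightarrow> 'a list set \<Rightarrow> 'a seqn set" where
  "avoiding_inf A F = {x \<in> inf_seqs A. \<forall>u. subblock u x \<longrightarrow> u \<notin> F}"

definition avoiding_fin :: "'a set \<Rightarrow> 'a list set \<Rightarrow> 'a seqn set" where
  "avoiding_fin A F =
     {FinSeq u | u. u \<in> lists A \<and>
        infinite {a \<in> A. \<exists>y \<in> inf_seqs A. prepend (u @ [a]) y \<in> avoiding_inf A F}}"

definition avoiding :: "'a set \<Rightarrow> 'a list set \<Rightarrow> 'a seqn set" where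
  "avoiding A F = avoiding_inf A F \<union> avoiding_fin A F"

definition step_shift_space :: "nat \<Rightarrow> 'a set \<Rightarrow> 'a seqn set \<Rightarrow> bool" where
  "step_shift_space M A X \<longleftrightarrow>
     shift_space A X \<and>
     (\<exists>F \<subseteq> lists A. (\<forall>u\<in>F. length u = M + 1) \<and> X = avoiding A F)"

section \<open>Edge shifts\<close>

text \<open>The source and range maps of a graph are \<open>tail\<close> and \<open>head\<close>.\<close>

definition countable_digraph :: "('v, 'e) pre_digraph \<Rightarrow> bool" where
  "countable_digraph E \<longleftrightarrow> wf_digraph E \<and> countable (verts E) \<and> countable (arcs E)"

definition sink :: "('v, 'e) pre_digraph \<Rightarrow> 'v \<Rightarrow> bool" where
  "sink E v \<longleftrightarrow> v \<in> verts E \<and> {e \<in> arcs E. tail E e = v} = {}"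

definition infinite_paths :: "('v, 'e) pre_digraph \<Rightarrow> 'e seqn set" where
  "infinite_paths E =
     InfSeq ` {e. range e \<subseteq> arcs E \<and> (\<forall>i. head E (e i) = tail E (e (Suc i)))}"

definition edge_shift_of :: "('v, 'e) pre_digraph \<Rightarrow> 'e seqn set" where
  "edge_shift_of E = full_shift (arcs E) closure_of infinite_paths E"

text \<open>Every countable graph is isomorphic to one whose vertices and edges are natural numbers,
  and renaming edges is a conjugacy; so the types below do not restrict the graphs.\<close>

definition edge_shift :: "'a set \<Rightarrow> 'a seqn set \<Rightarrow> bool" where
  "edge_shift A X \<longleftrightarrow>
     shift_space A X \<and>
     (\<exists>E :: (nat, nat) pre_digraph.
        countable_digraph E \<and> (\<forall>v. \<not> sink E v) \<and>
        conjugate A X (arcs E) (edge_shift_of E))"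

text \<open>Like being an edge shift, being an \<open>M\<close>-step shift space is considered up to conjugacy.
  Otherwise the equivalence fails: the shift over \<open>{0, 1}\<close> avoiding the block \<open>111\<close> is
  2-step and conjugate to an edge shift, but not 1-step. As graphs are countable, so are the alphabets here
  (again, renaming letters is a conjugacy): the constant sequences over an uncountable alphabet,
  with the empty sequence, form a row-finite 1-step shift space that is no edge shift, since
  an edge shift has only countably many infinite fixed points.\<close>

definition conjugate_to_step :: "nat \<Rightarrow> 'a set \<Rightarrow> 'a seqn set \<Rightarrow> bool" where
  "conjugate_to_step M A X \<longleftrightarrow>
     (\<exists>(B :: nat set) Y. step_shift_space M B Y \<and> conjugate A X B Y)"

end

theory Submission
  imports Defs
begin

text \<open>Row-finiteness leaves no nonempty finite sequence in a shift space, and this property passes to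
  every conjugate space. An \<open>M\<close>-step space without nonempty finite sequences is conjugate to the
  edge shift of its higher block graph, with the \<open>M\<close>-blocks as vertices and the \<open>(M + 1)\<close>-blocks as
  edges; the empty sequence belongs to both spaces or to neither, because finitely many letters form only
  finitely many \<open>(M + 1)\<close>-blocks. Conversely, the closure of the infinite
  sequences avoiding \<open>F\<close> is exactly the space defined by \<open>F\<close>, so an edge shift is the 1-step
  space that forbids the pairs of non-composable edges.\<close>

section \<open>Neighbourhoods in the full shift\<close>

text \<open>A section of the quotient map: among all preimages of a finite sequence under
  \<open>truncate_seq\<close>, it picks the one that stays at infinity after the end.\<close>

fun entry :: "'a seqn \<Rightarrow> nat \<Rightarrow> 'a option" where
  "entry (FinSeq u) i = (if i < length u then Some (u ! i) else None)"
| "entry (InfSeq f) i = Some (f i)"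

lemma truncate_seq_entry [simp]: "truncate_seq (entry x) = x"
  by (cases x) (auto simp: truncate_seq_eq_FinSeq_iff truncate_seq_eq_InfSeq_iff)

lemma entry_truncate_seq:
  "entry (truncate_seq f) i = (if \<exists>j\<le>i. f j = None then None else f i)"
proof (cases "truncate_seq f")
  case (FinSeq u)
  then have u: "f (length u) = None" "\<And>j. j < length u \<Longrightarrow> f j = Some (u ! j)"
    by (auto simp: truncate_seq_eq_FinSeq_iff)
  then show ?thesis
    unfolding FinSeq by (cases "i < length u") (auto simp: not_less)
next
  case (InfSeq g)
  then have "f = (\<lambda>i. Some (g i))"
    by (simp add: truncate_seq_eq_InfSeq_iff)
  then show ?thesis
    unfolding InfSeq by simp
qed

text \<open>These sets serve as neighbourhoods at both kinds of points. The point
  \<open>FinSeq w\<close> meets the last condition whatever \<open>K\<close> is, as its entry there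
  is \<open>None\<close>; with \<open>K\<close> empty the set is an ordinary cylinder.\<close>

definition gen_cylinder :: "'a set \<Rightarrow> 'a list \<Rightarrow> 'a set \<Rightarrow> 'a seqn set" where
  "gen_cylinder A w K =
     {x \<in> topspace (full_shift A).
        (\<forall>i<length w. entry x i = Some (w ! i)) \<and> entry x (length w) \<notin> Some ` K}"

lemma openin_product_topology_box:
  assumes "\<And>i. i \<le> n \<Longrightarrow> openin (X i) (V i)"
  shows "openin (product_topology X UNIV)
           {f \<in> topspace (product_topology X UNIV). \<forall>i\<le>(n::nat). f i \<in> V i}"
proof -
  let ?W = "\<lambda>i. if i \<le> n then V i else topspace (X i)"
  have sub: "V i \<subseteq> topspace (X i)" if "i \<le> n" for i
    using assms[OF that] by (rule openin_subset)
  have "{f \<in> topspace (product_topology X UNIV). \<forall>i\<le>n. f i \<in> V i} = PiE UNIV ?W"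
    using sub by (fastforce simp: PiE_UNIV_domain Pi_iff split: if_splits)
  moreover have "finite {i. ?W i \<noteq> topspace (X i)}"
    by (rule finite_subset[of _ "{..n}"]) auto
  ultimately show ?thesis
    using assms by (auto simp: openin_PiE_gen)
qed

text \<open>Compact sets of a discrete space are finite, so a set containing \<open>None\<close> is
  open as soon as it misses only finitely many letters.\<close>

lemma openin_Alexandroff_compactification_discrete:
  assumes "U \<subseteq> insert None (Some ` A)" "None \<in> U \<Longrightarrow> finite (Some ` A - U)"
  shows "openin (Alexandroff_compactification (discrete_topology A)) U"
proof (cases "None \<in> U")
  case True
  let ?C = "{a \<in> A. Some a \<notin> U}"
  have "Some ` ?C = Some ` A - U"
    by auto
  then have "finite ?C"
    using assms(2)[OF True] by (metis finite_image_iff inj_Some inj_on_subset subset_UNIV)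
  moreover have "U = insert None (Some ` (A - ?C))"
    using assms(1) True by auto
  ultimately show ?thesis
    unfolding openin_Alexandroff_compactification
    by (intro disjI2 exI[of _ ?C]) (simp add: compactin_discrete_topology)
next
  case False
  then have "U = Some ` {a \<in> A. Some a \<in> U}"
    using assms(1) by auto
  then show ?thesis
    unfolding openin_Alexandroff_compactification
    by (metis (no_types, lifting) mem_Collect_eq openin_discrete_topology subsetI)
qed

text \<open>The preimage under the quotient map restricts only the coordinates up to
  \<open>length w\<close>. Over an infinite alphabet the last of them ranges over infinity and the
  letters outside \<open>K\<close>, an open set because \<open>K\<close> is finite.\<close>

lemma openin_gen_cylinder:
  assumes "finite K"
  shows "openin (full_shift A) (gen_cylinder A w K)"
proof (cases "finite A")
  case True
  let ?T = "product_topology (\<lambda>_. discrete_topology A) (UNIV :: nat set)"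
  let ?V = "\<lambda>i. if i < length w then A \<inter> {w ! i} else A - K"
  have "{f \<in> topspace ?T. InfSeq f \<in> gen_cylinder A w K}
      = {f \<in> topspace ?T. \<forall>i\<le>length w. f i \<in> ?V i}"
    using True
    by (auto simp: gen_cylinder_def topspace_full_shift inf_seqs_def PiE_UNIV_domain Pi_iff
        split: if_splits)
  moreover have "openin ?T {f \<in> topspace ?T. \<forall>i\<le>length w. f i \<in> ?V i}"
    by (rule openin_product_topology_box) auto
  moreover have "gen_cylinder A w K \<subseteq> InfSeq ` topspace ?T"
    using True by (auto simp: gen_cylinder_def full_shift_def)
  ultimately show ?thesis
    using True by (simp add: full_shift_def openin_quotient_topology)
next
  case False
  let ?S = "Alexandroff_compactification (discrete_topology A)"
  let ?T = "product_topology (\<lambda>_. ?S) (UNIV :: nat set)"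
  let ?V = "\<lambda>i. if i < length w then Some ` A \<inter> {Some (w ! i)} else insert None (Some ` (A - K))"
  have "{f \<in> topspace ?T. truncate_seq f \<in> gen_cylinder A w K}
      = {f \<in> topspace ?T. \<forall>i\<le>length w. f i \<in> ?V i}" (is "?L = ?R")
  proof (intro Collect_cong conj_cong refl)
    fix f assume f: "f \<in> topspace ?T"
    then have fA: "f i \<in> insert None (Some ` A)" for i
      by (auto simp: PiE_UNIV_domain Pi_iff)
    have "truncate_seq f \<in> topspace (full_shift A)"
      using False f by (auto simp: full_shift_def)
    then have "truncate_seq f \<in> gen_cylinder A w K \<longleftrightarrow>
        (\<forall>i<length w. entry (truncate_seq f) i = Some (w ! i)) \<and>
        entry (truncate_seq f) (length w) \<notin> Some ` K"
      by (simp add: gen_cylinder_def)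
    \<comment> \<open>Truncation can change a coordinate only after an earlier \<open>None\<close>,
      which is impossible here up to position \<open>length w\<close> once the first
      \<open>length w\<close> coordinates are letters.\<close>
    also have "\<dots> \<longleftrightarrow> (\<forall>i<length w. f i = Some (w ! i)) \<and> f (length w) \<notin> Some ` K"
    proof -
      have "(\<forall>i<length w. entry (truncate_seq f) i = Some (w ! i)) \<longleftrightarrow>
          (\<forall>i<length w. f i = Some (w ! i))"
      proof (intro iffI allI impI)
        show "f i = Some (w ! i)"
          if "\<forall>i<length w. entry (truncate_seq f) i = Some (w ! i)" "i < length w" for i
          using that by (metis entry_truncate_seq option.distinct(1))
        show "entry (truncate_seq f) i = Some (w ! i)"
          if f: "\<forall>i<length w. f i = Some (w ! i)" and i: "i < length w" for i
        proof -
          have "f j \<noteq> None" if "j \<le> i" for j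
            using f i le_less_trans[OF that i] by simp
          then show ?thesis
            using f i by (auto simp: entry_truncate_seq)
        qed
      qed
      moreover have "entry (truncate_seq f) (length w) = f (length w)"
        if "\<forall>i<length w. f i = Some (w ! i)"
      proof (cases "f (length w)")
        case None
        then show ?thesis
          by (auto simp: entry_truncate_seq)
      next
        case (Some a)
        then have "f j \<noteq> None" if "j \<le> length w" for j
          using that \<open>\<forall>i<length w. f i = Some (w ! i)\<close> by (cases "j = length w") auto
        then have "\<not> (\<exists>j\<le>length w. f j = None)"
          by blast
        then show ?thesis
          by (simp only: entry_truncate_seq if_False)
      qed
      ultimately show ?thesis by metis
    qed
    also have "\<dots> \<longleftrightarrow> (\<forall>i\<le>length w. f i \<in> ?V i)"
    proof -
      have "f (length w) \<notin> Some ` K \<longleftrightarrow> f (length w) \<in> ?V (length w)"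
        using fA[of "length w"] by auto
      moreover have "f i = Some (w ! i) \<longleftrightarrow> f i \<in> ?V i" if "i < length w" for i
        using fA[of i] that by auto
      ultimately show ?thesis
        by (metis le_eq_less_or_eq)
    qed
    finally show "truncate_seq f \<in> gen_cylinder A w K \<longleftrightarrow> (\<forall>i\<le>length w. f i \<in> ?V i)" .
  qed
  moreover have "openin ?T {f \<in> topspace ?T. \<forall>i\<le>length w. f i \<in> ?V i}"
  proof (rule openin_product_topology_box)
    have "Some ` A - insert None (Some ` (A - K)) \<subseteq> Some ` K"
      by auto
    then have "finite (Some ` A - insert None (Some ` (A - K)))"
      using assms by (meson finite_imageI finite_subset)
    then show "openin ?S (?V i)" for i
      by (intro openin_Alexandroff_compactification_discrete) (auto split: if_splits)
  qed
  moreover have "gen_cylinder A w K \<subseteq> truncate_seq ` topspace ?T"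
    using False by (auto simp: gen_cylinder_def full_shift_def)
  ultimately show ?thesis
    using False by (simp add: full_shift_def openin_quotient_topology)
qed

lemma entry_in_alphabet:
  assumes "x \<in> topspace (full_shift A)"
  shows "entry x i \<in> insert None (Some ` A)"
proof (cases x)
  case (FinSeq u)
  then show ?thesis
    using assms by (auto simp: topspace_full_shift inf_seqs_def fin_seqs_def split: if_splits)
next
  case (InfSeq f)
  then show ?thesis
    using assms by (auto simp: topspace_full_shift inf_seqs_def fin_seqs_def split: if_splits)
qed

text \<open>An infinite sequence has just one preimage under the quotient map. A basic box around
  that preimage restricts finitely many coordinates, all below some \<open>n\<close>.\<close>

lemma full_shift_nbhd_InfSeq:
  assumes U: "openin (full_shift A) U" "InfSeq f \<in> U"
  obtains n where "\<And>x. \<lbrakk>x \<in> topspace (full_shift A); \<And>i. i < n \<Longrightarrow> entry x i = Some (f i)\<rbrakk> \<Longrightarrow> x \<in> U"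
proof -
  \<comment> \<open>The factor \<open>S\<close> is left arbitrary because finite and infinite
    alphabets use different factors.\<close>
  have box: "\<exists>n. \<forall>g. g \<in> topspace (product_topology (\<lambda>_. S) UNIV) \<longrightarrow> (\<forall>i<n. g i = h i) \<longrightarrow> g \<in> P"
    if P: "openin (product_topology (\<lambda>_. S) UNIV) P" "h \<in> P" for S :: "'b topology" and P and h :: "nat \<Rightarrow> 'b"
  proof -
    obtain W where W: "finite {i. W i \<noteq> topspace S}" "h \<in> PiE UNIV W" "PiE UNIV W \<subseteq> P"
      using P unfolding openin_product_topology_alt by fastforce
    obtain n where n: "\<And>i. W i \<noteq> topspace S \<Longrightarrow> i < n"
      using W(1) by (metis (mono_tags, lifting) finite_nat_set_iff_bounded mem_Collect_eq)
    have "g \<in> PiE UNIV W" if "g \<in> topspace (product_topology (\<lambda>_. S) UNIV)" "\<forall>i<n. g i = h i" for g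
    proof -
      have "g i \<in> W i" for i
      proof (cases "W i = topspace S")
        case True
        then show ?thesis
          using that(1) by (simp add: PiE_UNIV_domain Pi_iff)
      next
        case False
        then show ?thesis
          using that(2) n[OF False] W(2) by (simp add: PiE_UNIV_domain Pi_iff)
      qed
      then show ?thesis
        by (simp add: PiE_UNIV_domain)
    qed
    then show ?thesis
      using W(3) by (intro exI[of _ n] allI impI) (rule subsetD)
  qed
  show thesis
  proof (cases "finite A")
    case True
    let ?T = "product_topology (\<lambda>_. discrete_topology A) (UNIV :: nat set)"
    let ?P = "{g \<in> topspace ?T. InfSeq g \<in> U}"
    have P: "openin ?T ?P" and sub: "U \<subseteq> InfSeq ` topspace ?T"
      using U True by (auto simp: full_shift_def openin_quotient_topology)
    then have "f \<in> ?P"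
      using U(2) by auto
    from box[OF P this] obtain n where
      "\<forall>g. g \<in> topspace ?T \<longrightarrow> (\<forall>i<n. g i = f i) \<longrightarrow> g \<in> ?P"
      by (rule exE)
    then have n: "InfSeq g \<in> U" if "g \<in> topspace ?T" "\<forall>i<n. g i = f i" for g
      using that by simp
    show thesis
    proof (rule that)
      fix x assume x: "x \<in> topspace (full_shift A)" "\<And>i. i < n \<Longrightarrow> entry x i = Some (f i)"
      then obtain g where "x = InfSeq g" "g \<in> topspace ?T"
        using True by (auto simp: full_shift_def)
      then show "x \<in> U"
        using n x(2) by auto
    qed
  next
    case False
    let ?S = "Alexandroff_compactification (discrete_topology A)"
    let ?T = "product_topology (\<lambda>_. ?S) (UNIV :: nat set)"
    let ?P = "{g \<in> topspace ?T. truncate_seq g \<in> U}"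
    have P: "openin ?T ?P" and sub: "U \<subseteq> truncate_seq ` topspace ?T"
      using U False by (auto simp: full_shift_def openin_quotient_topology)
    have ent: "entry x \<in> topspace ?T" if "x \<in> topspace (full_shift A)" for x
      using entry_in_alphabet[OF that] by (simp add: PiE_UNIV_domain)
    have "InfSeq f \<in> topspace (full_shift A)"
      using U openin_subset by blast
    then have "entry (InfSeq f) \<in> ?P"
      using ent U(2) by simp
    from box[OF P this] obtain n where
      "\<forall>g. g \<in> topspace ?T \<longrightarrow> (\<forall>i<n. g i = entry (InfSeq f) i) \<longrightarrow> g \<in> ?P"
      by (rule exE)
    then have n: "truncate_seq g \<in> U"
      if "g \<in> topspace ?T" "\<forall>i<n. g i = entry (InfSeq f) i" for g
      using that by simp
    show thesis
    proof (rule that)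
      fix x assume x: "x \<in> topspace (full_shift A)" "\<And>i. i < n \<Longrightarrow> entry x i = Some (f i)"
      then show "x \<in> U"
        using n[of "entry x"] ent by simp
    qed
  qed
qed

text \<open>All continuations of \<open>u\<infinity>\<close> in the product represent \<open>u\<close>, so a neighbourhood of a single
  one of them does not suffice: the letters that must be excluded after \<open>u\<close> form a compact
  subset of the alphabet, as in the tube lemma.\<close>

lemma full_shift_nbhd_FinSeq:
  assumes U: "openin (full_shift A) U" "FinSeq u \<in> U"
  obtains K where "finite K" "gen_cylinder A u K \<subseteq> U"
proof (cases "finite A")
  case True
  \<comment> \<open>Over a finite alphabet every point has a letter of \<open>A\<close> at each
    position, so excluding all of \<open>A\<close> leaves the empty set.\<close>
  show thesis
    by (rule that[of A]) (use True in \<open>auto simp: gen_cylinder_def topspace_full_shift inf_seqs_def image_subset_iff\<close>)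
next
  case False
  let ?S = "Alexandroff_compactification (discrete_topology A)"
  let ?T = "product_topology (\<lambda>_. ?S) (UNIV :: nat set)"
  let ?P = "{g \<in> topspace ?T. truncate_seq g \<in> U}"
  let ?B = "PiE UNIV (\<lambda>i. if i < length u then {Some (u ! i)} else topspace ?S)"
  let ?n = "length u"
  have P: "openin ?T ?P"
    using U False by (auto simp: full_shift_def openin_quotient_topology)
  have "FinSeq u \<in> topspace (full_shift A)"
    using U openin_subset by blast
  then have uA: "u ! i \<in> A" if "i < ?n" for i
    using that by (auto simp: topspace_full_shift fin_seqs_def inf_seqs_def split: if_splits)
  have "closedin ?S {Some (u ! i)}" if "i < ?n" for i
    using closedin_Alexandroff_compactification_image_Some[of "discrete_topology A" "{u ! i}"] uA[OF that]
    by (simp add: compactin_discrete_topology)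
  then have "closedin ?S (if i < ?n then {Some (u ! i)} else topspace ?S)" for i
    by (simp del: topspace_Alexandroff_compactification)
  then have B: "closedin ?T ?B"
    unfolding closedin_product_topology by blast
  have "compact_space ?T"
    by (simp add: compact_space_product_topology)
  then have "compactin ?T (?B - ?P)"
    using closedin_diff[OF B P] by (rule closedin_compact_space)
  \<comment> \<open>\<open>D\<close> collects the entries after \<open>u\<close> in those
    continuations of \<open>u\<close> that are not sent into \<open>U\<close>. Infinity is not among
    them, since \<open>u\<close> followed by infinity represents \<open>FinSeq u\<close>, a point of
    \<open>U\<close>. So \<open>D\<close> is a compact, hence closed, set of letters in the
    compactification, and such a set is finite.\<close>
  define D where "D = (\<lambda>g. g ?n) ` (?B - ?P)"
  have comp: "compactin ?S D"
    unfolding D_def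
    by (rule image_compactin[OF \<open>compactin ?T (?B - ?P)\<close> continuous_map_product_projection[OF UNIV_I]])
  have "None \<notin> D"
  proof
    assume "None \<in> D"
    then obtain g where "None = g ?n" "g \<in> ?B - ?P"
      unfolding D_def by (rule imageE)
    then have g: "g \<in> ?B" "g \<notin> ?P" "g ?n = None"
      by simp_all
    have "g i = Some (u ! i)" if "i < ?n" for i
      using PiE_mem[OF g(1), of i] that by simp
    then have "truncate_seq g = FinSeq u"
      using g(3) by (simp add: truncate_seq_eq_FinSeq_iff)
    moreover have "g \<in> topspace ?T"
      using closedin_subset[OF B] g(1) by blast
    ultimately show False
      using g(2) U(2) by simp
  qed
  moreover have "D \<subseteq> insert None (Some ` A)"
    using compactin_subset_topspace[OF comp] by simp
  ultimately have "\<exists>K. D = Some ` K"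
    by (metis subset_imageE subset_insert)
  then obtain K where D: "D = Some ` K"
    by blast
  have "closedin ?S D"
    by (rule compactin_imp_closedin[OF _ comp])
       (simp add: Hausdorff_space_Alexandroff_compactification Hausdorff_space_discrete_topology
         locally_compact_space_discrete_topology)
  then have "finite K"
    unfolding D closedin_Alexandroff_compactification_image_Some compactin_discrete_topology
    by blast
  moreover have "gen_cylinder A u K \<subseteq> U"
  proof
    fix x assume x: "x \<in> gen_cylinder A u K"
    then have xA: "x \<in> topspace (full_shift A)"
      by (simp add: gen_cylinder_def)
    have top: "entry x \<in> topspace ?T"
      using entry_in_alphabet[OF xA] by (simp add: PiE_UNIV_domain)
    have "entry x \<in> ?B"
      using x entry_in_alphabet[OF xA] by (simp add: gen_cylinder_def PiE_UNIV_domain)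
    moreover have "entry x ?n \<notin> D"
      using x unfolding D by (simp add: gen_cylinder_def)
    ultimately have "entry x \<in> ?P"
      using imageI[of "entry x" "?B - ?P" "\<lambda>g. g ?n"] unfolding D_def by blast
    then show "x \<in> U"
      by simp
  qed
  ultimately show thesis
    by (rule that)
qed

section \<open>Sequences avoiding a set of blocks\<close>

lemma subblock_InfSeq_iff: "subblock u (InfSeq f) \<longleftrightarrow> (\<exists>i. u = map f [i..<i + length u])"
proof
  assume "subblock u (InfSeq f)"
  then obtain y z where yz: "InfSeq f = prepend y (prepend u z)"
    by (auto simp: subblock_def)
  then obtain g where "z = InfSeq g"
    by (cases z) auto
  with yz have f: "f = y \<frown> (u \<frown> g)"
    by simp
  have "u = map f [length y..<length y + length u]"
    by (rule nth_equalityI) (simp_all add: f nth_append)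
  then show "\<exists>i. u = map f [i..<i + length u]" ..
next
  assume "\<exists>i. u = map f [i..<i + length u]"
  then obtain i where i: "u = map f [i..<i + length u]" ..
  have nth: "u ! k = f (i + k)" if "k < length u" for k
    using that by (subst i) simp
  have "f = map f [0..<i] \<frown> (u \<frown> (\<lambda>n. f (n + i + length u)))"
  proof
    fix n
    show "f n = (map f [0..<i] \<frown> (u \<frown> (\<lambda>n. f (n + i + length u)))) n"
      using nth[of "n - i"] by (simp add: conc_def)
  qed
  then have "InfSeq f = prepend (map f [0..<i]) (prepend u (InfSeq (\<lambda>n. f (n + i + length u))))"
    by simp
  then show "subblock u (InfSeq f)"
    unfolding subblock_def by blast
qed

lemma InfSeq_avoiding_inf_iff:
  "InfSeq f \<in> avoiding_inf A F \<longleftrightarrow> range f \<subseteq> A \<and> (\<forall>i n. map f [i..<i + n] \<notin> F)"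
proof -
  have "(\<forall>u. subblock u (InfSeq f) \<longrightarrow> u \<notin> F) \<longleftrightarrow> (\<forall>i n. map f [i..<i + n] \<notin> F)"
    unfolding subblock_InfSeq_iff by (metis add_diff_cancel_left' length_map length_upt)
  then show ?thesis
    by (auto simp: avoiding_inf_def inf_seqs_def)
qed

lemma avoiding_inf_suffix:
  assumes "InfSeq f \<in> avoiding_inf A F"
  shows "InfSeq (\<lambda>n. f (n + k)) \<in> avoiding_inf A F"
proof -
  have "map (\<lambda>n. f (n + k)) [i..<i + n] = map f [i + k..<i + k + n]" for i n
    by (rule nth_equalityI) (simp_all add: algebra_simps)
  then show ?thesis
    using assms by (auto simp: InfSeq_avoiding_inf_iff)
qed

text \<open>This rephrases the extension condition for finite sequences in terms of whole infinite
  sequences. It is applied both to the sequences avoiding \<open>F\<close> and to the infinite paths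
  of a graph, which makes the two comparable.\<close>

definition followers :: "'a seqn set \<Rightarrow> 'a list \<Rightarrow> 'a set" where
  "followers S u = {f (length u) | f. InfSeq f \<in> S \<and> map f [0..<length u] = u}"

lemma followersI: "\<lbrakk>InfSeq f \<in> S; map f [0..<length u] = u\<rbrakk> \<Longrightarrow> f (length u) \<in> followers S u"
  by (auto simp: followers_def)

lemma followers_avoiding_inf:
  "{a \<in> A. \<exists>y \<in> inf_seqs A. prepend (u @ [a]) y \<in> avoiding_inf A F} = followers (avoiding_inf A F) u"
  (is "?L = ?R")
proof (intro equalityI subsetI)
  fix a assume "a \<in> ?L"
  then obtain g where g: "InfSeq ((u @ [a]) \<frown> g) \<in> avoiding_inf A F"
    by (auto simp: inf_seqs_def)
  have "map ((u @ [a]) \<frown> g) [0..<length u] = u"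
    by (rule nth_equalityI) (simp_all add: nth_append)
  moreover have "((u @ [a]) \<frown> g) (length u) = a"
    by simp
  ultimately show "a \<in> ?R"
    using g unfolding followers_def by (metis (mono_tags, lifting) mem_Collect_eq)
next
  fix a assume "a \<in> ?R"
  then obtain f where f: "InfSeq f \<in> avoiding_inf A F" "map f [0..<length u] = u" "a = f (length u)"
    by (auto simp: followers_def)
  let ?g = "\<lambda>n. f (n + Suc (length u))"
  have nth: "u ! i = f i" if "i < length u" for i
    using that by (subst f(2)[symmetric]) simp
  have "f = (u @ [a]) \<frown> ?g"
  proof
    show "f n = ((u @ [a]) \<frown> ?g) n" for n
      using nth[of n] f(3) by (cases n "length u" rule: linorder_cases) (simp_all add: conc_def nth_append)
  qed
  then have "prepend (u @ [a]) (InfSeq ?g) \<in> avoiding_inf A F"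
    using f(1) by simp
  moreover have "range f \<subseteq> A"
    using f(1) by (simp add: InfSeq_avoiding_inf_iff)
  moreover from this have "InfSeq ?g \<in> inf_seqs A"
    by (auto simp: inf_seqs_def)
  moreover have "a \<in> A"
    using \<open>range f \<subseteq> A\<close> f(3) by auto
  ultimately show "a \<in> ?L"
    by (intro CollectI conjI bexI[of _ "InfSeq ?g"])
qed

lemma InfSeq_avoiding_iff: "InfSeq f \<in> avoiding A F \<longleftrightarrow> InfSeq f \<in> avoiding_inf A F"
  by (auto simp: avoiding_def avoiding_fin_def)

lemma FinSeq_avoiding_iff:
  "FinSeq u \<in> avoiding A F \<longleftrightarrow> infinite (followers (avoiding_inf A F) u)"
proof -
  \<comment> \<open>Infinitely many followers give at least one, and then \<open>u\<close> is the
    beginning of a sequence over \<open>A\<close>.\<close>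
  have "u \<in> lists A" if "infinite (followers (avoiding_inf A F) u)"
  proof -
    have "followers (avoiding_inf A F) u \<noteq> {}"
      using that by (metis finite.emptyI)
    then obtain f where f: "InfSeq f \<in> avoiding_inf A F" "map f [0..<length u] = u"
      unfolding followers_def by blast
    have "set (map f [0..<length u]) \<subseteq> A"
      using f(1) by (auto simp: InfSeq_avoiding_inf_iff)
    then show ?thesis
      using f(2) by auto
  qed
  then show ?thesis
    unfolding avoiding_def avoiding_fin_def followers_avoiding_inf
    by (auto simp: avoiding_inf_def inf_seqs_def)
qed

lemma followers_avoiding_inf_subset: "followers (avoiding_inf A F) u \<subseteq> A"
  by (auto simp: followers_def InfSeq_avoiding_inf_iff)

lemma avoiding_subset_topspace: "avoiding A F \<subseteq> topspace (full_shift A)"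
proof
  fix x assume x: "x \<in> avoiding A F"
  show "x \<in> topspace (full_shift A)"
  proof (cases x)
    case (InfSeq f)
    then show ?thesis
      using x by (auto simp: InfSeq_avoiding_iff avoiding_inf_def topspace_full_shift)
  next
    case (FinSeq u)
    \<comment> \<open>The full shift over a finite alphabet has no finite points; infinitely many
      followers rule that case out.\<close>
    then have "infinite A"
      using x followers_avoiding_inf_subset FinSeq_avoiding_iff finite_subset by metis
    then show ?thesis
      using x FinSeq
      by (auto simp: avoiding_def avoiding_fin_def avoiding_inf_def topspace_full_shift fin_seqs_def)
  qed
qed

text \<open>A finite point has a follower, and the sequence witnessing it begins with that point.
  Closedness can thus be tested on infinite sequences for both kinds of points.\<close>

lemma avoiding_extends_to_InfSeq:
  assumes "x \<in> avoiding A F"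
  obtains g where "InfSeq g \<in> avoiding_inf A F" "\<And>i a. entry x i = Some a \<Longrightarrow> a = g i"
proof (cases x)
  case (InfSeq f)
  then show thesis
    using that[of f] assms by (simp add: InfSeq_avoiding_iff)
next
  case (FinSeq u)
  then have "followers (avoiding_inf A F) u \<noteq> {}"
    using assms by (metis FinSeq_avoiding_iff finite.emptyI)
  then obtain g where g: "InfSeq g \<in> avoiding_inf A F" "map g [0..<length u] = u"
    unfolding followers_def by blast
  have "u ! i = g i" if "i < length u" for i
    using that by (subst g(2)[symmetric]) simp
  then have "a = g i" if "entry x i = Some a" for i a
    using that FinSeq by (auto split: if_splits)
  then show thesis
    by (rule that[OF g(1)])
qed

text \<open>An infinite sequence outside the set shows a forbidden block in some prefix, and the
  cylinder of that prefix misses the set. A finite \<open>u\<close> outside it has finitely many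
  followers; a point of the set that starts with \<open>u\<close> is \<open>u\<close> itself or
  continues with a follower, so excluding the followers separates \<open>u\<close> from the
  set.\<close>

lemma closedin_avoiding: "closedin (full_shift A) (avoiding A F)"
proof -
  have "\<exists>T. openin (full_shift A) T \<and> x \<in> T \<and> T \<subseteq> topspace (full_shift A) - avoiding A F"
    if x: "x \<in> topspace (full_shift A) - avoiding A F" for x
  proof (cases x)
    case (InfSeq f)
    then have "range f \<subseteq> A"
      using x by (auto simp: topspace_full_shift inf_seqs_def fin_seqs_def split: if_splits)
    then obtain i n where F: "map f [i..<i + n] \<in> F"
      using x InfSeq by (auto simp: InfSeq_avoiding_iff InfSeq_avoiding_inf_iff)
    let ?T = "gen_cylinder A (map f [0..<i + n]) {}"
    have "y \<notin> avoiding A F" if "y \<in> ?T" for y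
    proof
      assume "y \<in> avoiding A F"
      then obtain g where g: "InfSeq g \<in> avoiding_inf A F" "\<And>i a. entry y i = Some a \<Longrightarrow> a = g i"
        using avoiding_extends_to_InfSeq by blast
      have "f j = g j" if "j < i + n" for j
        using \<open>y \<in> ?T\<close> g(2) that by (auto simp: gen_cylinder_def)
      then have "map g [i..<i + n] = map f [i..<i + n]"
        by simp
      then show False
        using F g(1) unfolding InfSeq_avoiding_inf_iff by metis
    qed
    moreover have "x \<in> ?T"
      using x InfSeq by (simp add: gen_cylinder_def)
    moreover have "?T \<subseteq> topspace (full_shift A)"
      by (auto simp: gen_cylinder_def)
    ultimately show ?thesis
      using openin_gen_cylinder[OF finite.emptyI] by (intro exI[of _ ?T]) blast
  next
    case (FinSeq u)
    let ?K = "followers (avoiding_inf A F) u"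
    let ?T = "gen_cylinder A u ?K"
    have "finite ?K"
      using x FinSeq by (simp add: FinSeq_avoiding_iff)
    have "y \<notin> avoiding A F" if "y \<in> ?T" for y
    proof
      assume y: "y \<in> avoiding A F"
      then obtain g where g: "InfSeq g \<in> avoiding_inf A F" "\<And>i a. entry y i = Some a \<Longrightarrow> a = g i"
        using avoiding_extends_to_InfSeq by blast
      have yu: "entry y i = Some (u ! i)" if "i < length u" for i
        using \<open>y \<in> ?T\<close> that by (simp add: gen_cylinder_def)
      then have gu: "map g [0..<length u] = u"
        using g(2) by (intro nth_equalityI) auto
      show False
      proof (cases "entry y (length u)")
        case None
        then have "y = x"
        proof (cases y)
          case (FinSeq v)
          with None have "length v \<le> length u"
            by (simp split: if_splits)
          moreover have "length u \<le> length v"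
            using yu[of "length v"] FinSeq by (cases "length u \<le> length v") auto
          ultimately have "v = u"
            using yu FinSeq by (intro nth_equalityI) auto
          then show ?thesis
            using FinSeq \<open>x = FinSeq u\<close> by simp
        qed simp
        then show False
          using x y by simp
      next
        case (Some b)
        then have "b \<in> ?K"
          using followersI[OF g(1) gu] g(2) by auto
        then show False
          using Some \<open>y \<in> ?T\<close> by (simp add: gen_cylinder_def)
      qed
    qed
    moreover have "x \<in> ?T"
      using x FinSeq by (auto simp: gen_cylinder_def)
    moreover have "?T \<subseteq> topspace (full_shift A)"
      by (auto simp: gen_cylinder_def)
    ultimately show ?thesis
      using openin_gen_cylinder[OF \<open>finite ?K\<close>] by (intro exI[of _ ?T]) blast
  qed
  then have "openin (full_shift A) (topspace (full_shift A) - avoiding A F)"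
    by (subst openin_subopen) blast
  then show ?thesis
    using avoiding_subset_topspace by (simp add: closedin_def)
qed

text \<open>Dropping the first letter of a witness shows that the followers of a nonempty block also
  follow its tail, so infinitely many remain. The empty sequence is fixed by
  \<open>shift\<close>.\<close>

lemma shift_avoiding: "shift ` avoiding A F \<subseteq> avoiding A F"
proof clarify
  fix x assume x: "x \<in> avoiding A F"
  show "shift x \<in> avoiding A F"
  proof (cases x)
    case (InfSeq f)
    then show ?thesis
      using avoiding_inf_suffix[of f A F 1] x by (simp add: InfSeq_avoiding_iff)
  next
    case (FinSeq u)
    show ?thesis
    proof (cases u)
      case Nil
      then show ?thesis
        using x FinSeq by simp
    next
      case (Cons a v)
      have "followers (avoiding_inf A F) u \<subseteq> followers (avoiding_inf A F) v"
      proof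
        fix b assume "b \<in> followers (avoiding_inf A F) u"
        then obtain f where f: "InfSeq f \<in> avoiding_inf A F" "map f [0..<length u] = u" "b = f (length u)"
          by (auto simp: followers_def)
        have "u ! i = f i" if "i < length u" for i
          using that by (subst f(2)[symmetric]) simp
        then have "map (\<lambda>n. f (n + 1)) [0..<length v] = v"
          using Cons by (intro nth_equalityI) fastforce+
        moreover have "b = (\<lambda>n. f (n + 1)) (length v)"
          using f(3) Cons by simp
        ultimately show "b \<in> followers (avoiding_inf A F) v"
          using followersI[OF avoiding_inf_suffix[OF f(1), of 1]] by simp
      qed
      then show ?thesis
        using x FinSeq Cons by (auto simp: FinSeq_avoiding_iff dest: finite_subset)
    qed
  qed
qed

lemma shift_space_avoiding: "shift_space A (avoiding A F)"
  unfolding shift_space_def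
proof (intro conjI allI impI closedin_avoiding shift_avoiding)
  fix u assume "FinSeq u \<in> avoiding A F"
  then have inf: "infinite {a \<in> A. \<exists>y \<in> inf_seqs A. prepend (u @ [a]) y \<in> avoiding_inf A F}"
    by (simp add: followers_avoiding_inf FinSeq_avoiding_iff)
  show "infinite {a \<in> A. \<exists>y \<in> topspace (full_shift A). prepend (u @ [a]) y \<in> avoiding A F}"
    by (rule infinite_super[OF _ inf]) (auto simp: topspace_full_shift avoiding_def)
qed

text \<open>A neighbourhood of a finite point contains a generalized cylinder excluding finitely
  many next letters, while the point has infinitely many followers. One of them survives and yields
  an infinite sequence in the neighbourhood.\<close>

lemma closure_of_avoiding_inf: "full_shift A closure_of avoiding_inf A F = avoiding A F"
proof
  show "full_shift A closure_of avoiding_inf A F \<subseteq> avoiding A F"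
    by (rule closure_of_minimal[OF _ closedin_avoiding]) (simp add: avoiding_def)
  show "avoiding A F \<subseteq> full_shift A closure_of avoiding_inf A F"
  proof
    fix x assume x: "x \<in> avoiding A F"
    have "\<exists>y. y \<in> avoiding_inf A F \<and> y \<in> U" if U: "x \<in> U" "openin (full_shift A) U" for U
    proof (cases x)
      case (InfSeq f)
      then show ?thesis
        using x U(1) by (auto simp: InfSeq_avoiding_iff)
    next
      case (FinSeq u)
      then obtain K where K: "finite K" "gen_cylinder A u K \<subseteq> U"
        using full_shift_nbhd_FinSeq U by metis
      have "infinite (followers (avoiding_inf A F) u)"
        using x FinSeq by (simp add: FinSeq_avoiding_iff)
      then obtain a where "a \<in> followers (avoiding_inf A F) u" "a \<notin> K"
        using K(1) by (meson finite_subset subsetI)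
      then obtain f where f: "InfSeq f \<in> avoiding_inf A F" "map f [0..<length u] = u" "f (length u) \<notin> K"
        by (auto simp: followers_def)
      have "f i = u ! i" if "i < length u" for i
        using that by (subst f(2)[symmetric]) simp
      moreover have "InfSeq f \<in> topspace (full_shift A)"
        using f(1) by (auto simp: avoiding_inf_def topspace_full_shift)
      ultimately have "InfSeq f \<in> gen_cylinder A u K"
        using f(3) by (auto simp: gen_cylinder_def)
      then show ?thesis
        using f(1) K(2) by blast
    qed
    then show "x \<in> full_shift A closure_of avoiding_inf A F"
      using x avoiding_subset_topspace by (auto simp: in_closure_of)
  qed
qed

section \<open>Edge shifts as 1-step shift spaces\<close>

definition broken_pairs :: "('v, 'e) pre_digraph \<Rightarrow> 'e list set" where
  "broken_pairs E = {[e, e'] | e e'. e \<in> arcs E \<and> e' \<in> arcs E \<and> head E e \<noteq> tail E e'}"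

lemma infinite_paths_eq_avoiding_inf: "infinite_paths E = avoiding_inf (arcs E) (broken_pairs E)"
proof -
  have "InfSeq f \<in> infinite_paths E \<longleftrightarrow> InfSeq f \<in> avoiding_inf (arcs E) (broken_pairs E)" for f
  proof -
    have pair: "map f [i..<i + 2] = [f i, f (Suc i)]" for i
      by (simp add: upt_rec)
    have "map f [i..<i + n] = [e, e'] \<longleftrightarrow> n = 2 \<and> e = f i \<and> e' = f (Suc i)" for i n e e'
    proof
      assume "map f [i..<i + n] = [e, e']"
      moreover from this have "n = 2"
        by (auto dest: arg_cong[where f = length])
      ultimately show "n = 2 \<and> e = f i \<and> e' = f (Suc i)"
        using pair by simp
    qed (use pair in auto)
    then have "map f [i..<i + n] \<in> broken_pairs E \<longleftrightarrow> n = 2 \<and> head E (f i) \<noteq> tail E (f (Suc i))"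
      if "range f \<subseteq> arcs E" for i n
      using that by (auto simp: broken_pairs_def)
    then show ?thesis
      by (auto simp: InfSeq_avoiding_inf_iff infinite_paths_def)
  qed
  moreover have "x \<in> range InfSeq" if "x \<in> infinite_paths E \<union> avoiding_inf (arcs E) (broken_pairs E)" for x
    using that by (auto simp: infinite_paths_def avoiding_inf_def inf_seqs_def)
  ultimately show ?thesis
    by blast
qed

lemma edge_shift_of_eq_avoiding: "edge_shift_of E = avoiding (arcs E) (broken_pairs E)"
  by (simp add: edge_shift_of_def infinite_paths_eq_avoiding_inf closure_of_avoiding_inf)

lemma step_shift_space_edge_shift_of: "step_shift_space 1 (arcs E) (edge_shift_of E)"
  unfolding step_shift_space_def edge_shift_of_eq_avoiding
  by (intro conjI shift_space_avoiding exI[of _ "broken_pairs E"]) (auto simp: broken_pairs_def)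

text \<open>The edges of the graph are natural numbers, so the edge shift itself is the required
  1-step space, with the same conjugacy.\<close>

lemma edge_shift_imp_conjugate_to_1_step: "edge_shift A X \<Longrightarrow> conjugate_to_step 1 A X"
  unfolding edge_shift_def conjugate_to_step_def using step_shift_space_edge_shift_of by blast

section \<open>The higher block graph\<close>

text \<open>Blocks are coded by natural numbers because the graphs in the definition of an edge shift
  have natural numbers as vertices and edges.\<close>

definition block_code :: "nat \<Rightarrow> (nat \<Rightarrow> 'a::countable) \<Rightarrow> nat \<Rightarrow> nat" where
  "block_code k f i = to_nat (map f [i..<i + k])"

text \<open>Reading blocks at position 0 only loses nothing for the sets \<open>S\<close> used
  below, which are closed under dropping initial letters. Composable edges are blocks overlapping in
  \<open>M\<close> letters.\<close>

definition block_graph :: "nat \<Rightarrow> 'a::countable seqn set \<Rightarrow> (nat, nat) pre_digraph" where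
  "block_graph M S =
     \<lparr>verts = {block_code M f 0 | f. InfSeq f \<in> S},
      arcs = {block_code (Suc M) f 0 | f. InfSeq f \<in> S},
      tail = \<lambda>e. to_nat (butlast (from_nat e :: 'a list)),
      head = \<lambda>e. to_nat (tl (from_nat e :: 'a list))\<rparr>"

text \<open>The value on finite sequences is right only for the empty one, the only finite sequence
  that occurs in the spaces to which the map is applied.\<close>

fun block_map :: "nat \<Rightarrow> 'a::countable seqn \<Rightarrow> nat seqn" where
  "block_map M (FinSeq u) = FinSeq []"
| "block_map M (InfSeq f) = InfSeq (block_code (Suc M) f)"

lemma block_code_eq_iff:
  "block_code k f i = block_code k g j \<longleftrightarrow> (\<forall>n<k. f (i + n) = g (j + n))"
  by (simp add: block_code_def list_eq_iff_nth_eq)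

lemma from_nat_block_code [simp]: "from_nat (block_code k f i) = map f [i..<i + k]"
  by (simp add: block_code_def)

lemma block_code_shift: "block_code k (\<lambda>n. f (n + j)) i = block_code k f (i + j)"
  by (simp add: block_code_eq_iff algebra_simps)

lemma tail_block_code [simp]:
  fixes f :: "nat \<Rightarrow> 'a::countable" and S :: "'a seqn set"
  shows "tail (block_graph M S) (block_code (Suc M) f i) = block_code M f i"
  by (simp add: block_graph_def) (simp add: block_code_def)

lemma head_block_code [simp]:
  fixes f :: "nat \<Rightarrow> 'a::countable" and S :: "'a seqn set"
  shows "head (block_graph M S) (block_code (Suc M) f i) = block_code M f (Suc i)"
  by (simp add: block_graph_def del: upt_Suc)
     (simp add: block_code_def list_eq_iff_nth_eq nth_tl del: upt_Suc)

text \<open>The second assumption is the trace of row-finiteness that survives conjugacy.\<close>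

locale higher_block =
  fixes B :: "'a::countable set" and F :: "'a list set" and M :: nat
  assumes length_forbidden: "u \<in> F \<Longrightarrow> length u = Suc M"
    and FinSeq_only_empty: "FinSeq u \<in> avoiding B F \<Longrightarrow> u = []"
begin

abbreviation V where "V \<equiv> avoiding_inf B F"

abbreviation G where "G \<equiv> block_graph M V"

lemma verts_G: "verts G = {block_code M f 0 | f. InfSeq f \<in> V}"
  and arcs_G: "arcs G = {block_code (Suc M) f 0 | f. InfSeq f \<in> V}"
  by (simp_all add: block_graph_def)

lemma block_code_in_arcs: "InfSeq f \<in> V \<Longrightarrow> block_code (Suc M) f i \<in> arcs G"
  unfolding arcs_G using avoiding_inf_suffix[of f B F i] block_code_shift[of "Suc M" f i 0, symmetric]
  by (simp only: add_0) blast

lemma block_code_in_verts: "InfSeq f \<in> V \<Longrightarrow> block_code M f i \<in> verts G"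
  unfolding verts_G using avoiding_inf_suffix[of f B F i] block_code_shift[of M f i 0, symmetric]
  by (simp only: add_0) blast

lemma countable_digraph_G: "countable_digraph G"
proof -
  have "tail G e \<in> verts G \<and> head G e \<in> verts G" if "e \<in> arcs G" for e
    using that block_code_in_verts by (auto simp: arcs_G)
  then show ?thesis
    by (auto simp: countable_digraph_def wf_digraph_def)
qed

text \<open>A vertex is the beginning of a sequence in \<open>V\<close>; one more letter of that
  sequence gives an edge leaving it.\<close>

lemma not_sink_G: "\<not> sink G v"
proof
  assume "sink G v"
  then obtain f where f: "InfSeq f \<in> V" "v = block_code M f 0"
    by (auto simp: sink_def verts_G)
  then have "block_code (Suc M) f 0 \<in> {e \<in> arcs G. tail G e = v}"
    using block_code_in_arcs by simp
  then show False
    using \<open>sink G v\<close> by (auto simp: sink_def)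
qed

text \<open>The overlapping blocks of a path glue to one sequence. It avoids \<open>F\<close>
  because forbidden blocks have length \<open>M + 1\<close>, and each of its windows of that length
  is an edge, hence taken from a sequence in \<open>V\<close>.\<close>

lemma infinite_paths_G: "InfSeq e \<in> infinite_paths G \<longleftrightarrow> (\<exists>f. InfSeq f \<in> V \<and> e = block_code (Suc M) f)"
proof
  assume "\<exists>f. InfSeq f \<in> V \<and> e = block_code (Suc M) f"
  then show "InfSeq e \<in> infinite_paths G"
    using block_code_in_arcs by (auto simp: infinite_paths_def)
next
  assume "InfSeq e \<in> infinite_paths G"
  then have e: "e i \<in> arcs G" "head G (e i) = tail G (e (Suc i))" for i
    by (auto simp: infinite_paths_def)
  have "\<exists>f. InfSeq f \<in> V \<and> e i = block_code (Suc M) f 0" for i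
    using e(1)[of i] by (auto simp: arcs_G)
  then obtain w where w: "InfSeq (w i) \<in> V" "e i = block_code (Suc M) (w i) 0" for i
    by metis
  define f where "f i = w i 0" for i
  have step: "w i (Suc j) = w (Suc i) j" if "j < M" for i j
    using e(2)[of i] that by (simp add: w(2) block_code_eq_iff)
  \<comment> \<open>By \<open>step\<close>, a letter of one edge reappears one place earlier in the
    next edge; after \<open>j\<close> edges it has become the first letter, which is what
    \<open>f\<close> records.\<close>
  have wf: "w i j = f (i + j)" if "j \<le> M" for i j
    using that
  proof (induction j arbitrary: i)
    case (Suc j)
    then show ?case
      using step[of j i] Suc.IH[of "Suc i"] by simp
  qed (simp add: f_def)
  have "e i = block_code (Suc M) f i" for i
    using wf by (simp add: w(2) block_code_eq_iff)
  moreover have "InfSeq f \<in> V"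
    unfolding InfSeq_avoiding_inf_iff
  proof (intro conjI allI notI)
    have "range (w i) \<subseteq> B" for i
      using w(1) by (simp add: InfSeq_avoiding_inf_iff)
    then show "range f \<subseteq> B"
      by (auto simp: f_def)
  next
    fix i n assume F: "map f [i..<i + n] \<in> F"
    then have n: "n = Suc M"
      using length_forbidden by fastforce
    have "map f [i..<i + n] = map (w i) [0..<0 + Suc M]"
      using wf by (intro nth_equalityI) (simp_all add: n del: upt_Suc)
    then show False
      using F w(1)[of i] unfolding InfSeq_avoiding_inf_iff by metis
  qed
  ultimately show "\<exists>f. InfSeq f \<in> V \<and> e = block_code (Suc M) f"
    by blast
qed

lemma followers_paths:
  "followers (infinite_paths G) u =
     {block_code (Suc M) f (length u) | f. InfSeq f \<in> V \<and> map (block_code (Suc M) f) [0..<length u] = u}"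
  unfolding followers_def infinite_paths_G by blast

lemma InfSeq_edge_shift_G: "InfSeq e \<in> edge_shift_of G \<longleftrightarrow> InfSeq e \<in> infinite_paths G"
  by (simp add: edge_shift_of_eq_avoiding InfSeq_avoiding_iff infinite_paths_eq_avoiding_inf)

lemma FinSeq_edge_shift_G: "FinSeq u \<in> edge_shift_of G \<longleftrightarrow> infinite (followers (infinite_paths G) u)"
  by (simp add: edge_shift_of_eq_avoiding FinSeq_avoiding_iff infinite_paths_eq_avoiding_inf)

text \<open>Infinitely many initial letters give infinitely many edges, since each is the first
  letter of an edge; conversely, the edges are words of length \<open>M + 1\<close> over the initial
  letters.\<close>

lemma Nil_edge_shift_G: "FinSeq [] \<in> edge_shift_of G \<longleftrightarrow> FinSeq [] \<in> avoiding B F"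
proof -
  let ?K = "followers V []"
  let ?L = "followers (infinite_paths G) []"
  have K: "?K = {f 0 | f. InfSeq f \<in> V}"
    by (simp add: followers_def)
  have L: "?L = {block_code (Suc M) f 0 | f. InfSeq f \<in> V}"
    by (simp add: followers_paths)
  have "?K \<subseteq> (\<lambda>e. hd (from_nat e)) ` ?L"
  proof
    fix a assume "a \<in> ?K"
    then obtain f where f: "InfSeq f \<in> V" "a = f 0"
      by (auto simp: K)
    then have "block_code (Suc M) f 0 \<in> ?L"
      by (auto simp: L)
    moreover have "a = hd (from_nat (block_code (Suc M) f 0))"
      using f(2) by (simp add: upt_rec)
    ultimately show "a \<in> (\<lambda>e. hd (from_nat e)) ` ?L"
      by blast
  qed
  moreover have "?L \<subseteq> to_nat ` {w. set w \<subseteq> ?K \<and> length w = Suc M}"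
  proof
    fix e assume "e \<in> ?L"
    then obtain f where f: "InfSeq f \<in> V" "e = block_code (Suc M) f 0"
      by (auto simp: L)
    \<comment> \<open>Dropping \<open>i\<close> letters turns any letter of \<open>f\<close> into an
      initial letter of a sequence in \<open>V\<close>.\<close>
    have "f i \<in> ?K" for i
      using followersI[OF avoiding_inf_suffix[OF f(1), of i], of "[]"] by simp
    then have "map f [0..<0 + Suc M] \<in> {w. set w \<subseteq> ?K \<and> length w = Suc M}"
      by auto
    then show "e \<in> to_nat ` {w. set w \<subseteq> ?K \<and> length w = Suc M}"
      unfolding f(2) block_code_def by (rule imageI)
  qed
  ultimately have "finite ?K \<longleftrightarrow> finite ?L"
    using finite_lists_length_eq[of ?K "Suc M"] by (blast intro: finite_surj)
  then show ?thesis
    by (simp add: FinSeq_edge_shift_G FinSeq_avoiding_iff)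
qed

text \<open>Infinitely many edges leaving the last edge of \<open>u\<close> amount to infinitely many letters
  following the block that this edge represents.\<close>

lemma FinSeq_edge_shift_G_empty:
  assumes "FinSeq u \<in> edge_shift_of G"
  shows "u = []"
proof (rule ccontr)
  assume "u \<noteq> []"
  \<comment> \<open>The last edge of \<open>u\<close>, decoded. Every sequence whose path begins
    with \<open>u\<close> shows this block at position \<open>?m\<close>.\<close>
  define w :: "'a list" where "w = from_nat (last u)"
  let ?m = "length u - 1"
  have w: "map f [?m..<?m + Suc M] = w" if "map (block_code (Suc M) f) [0..<length u] = u" for f
  proof -
    have "last u = block_code (Suc M) f ?m"
      using \<open>u \<noteq> []\<close> by (subst that[symmetric]) (simp add: last_map)
    then show ?thesis
      by (simp only: w_def from_nat_block_code)
  qed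
  have inf: "infinite (followers (infinite_paths G) u)"
    using assms by (simp add: FinSeq_edge_shift_G)
  then have "followers (infinite_paths G) u \<noteq> {}"
    by (metis finite.emptyI)
  then obtain f0 :: "nat \<Rightarrow> 'a" where f0: "map (block_code (Suc M) f0) [0..<length u] = u"
    unfolding followers_paths by blast
  have len: "length w = Suc M"
    using w[OF f0] by auto
  have "followers (infinite_paths G) u \<subseteq> (\<lambda>b. to_nat (tl w @ [b])) ` followers V w"
  proof
    fix a assume "a \<in> followers (infinite_paths G) u"
    then obtain f where f: "InfSeq f \<in> V" "map (block_code (Suc M) f) [0..<length u] = u"
      "a = block_code (Suc M) f (length u)"
      by (auto simp: followers_paths)
    \<comment> \<open>\<open>followers\<close> looks at initial segments only, so \<open>f\<close>
      is shifted until \<open>w\<close> is at its start. The next edge is then the window at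
      position 1: it drops the first letter of \<open>w\<close> and appends a follower of
      \<open>w\<close>.\<close>
    let ?g = "\<lambda>n. f (n + ?m)"
    have "map ?g [0..<length w] = map f [?m..<?m + Suc M]"
      by (rule nth_equalityI) (simp_all add: len algebra_simps del: upt_Suc)
    then have g: "map ?g [0..<length w] = w"
      using w[OF f(2)] by simp
    have "a = block_code (Suc M) ?g 1"
      using f(3) \<open>u \<noteq> []\<close> by (simp add: block_code_shift)
    also have "\<dots> = to_nat (tl (map ?g [0..<length w]) @ [?g (length w)])"
      by (simp add: block_code_def len flip: map_tl)
    finally have "a = to_nat (tl w @ [?g (length w)])"
      unfolding g .
    moreover have "?g (length w) \<in> followers V w"
      using avoiding_inf_suffix[OF f(1)] g by (rule followersI)
    ultimately show "a \<in> (\<lambda>b. to_nat (tl w @ [b])) ` followers V w"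
      by blast
  qed
  then have "infinite (followers V w)"
    using inf by (meson finite_imageI finite_subset)
  then have "w = []"
    using FinSeq_only_empty by (simp add: FinSeq_avoiding_iff)
  then show False
    using len by simp
qed

lemma bij_betw_block_map: "bij_betw (block_map M) (avoiding B F) (edge_shift_of G)"
proof (rule bij_betw_imageI)
  show "inj_on (block_map M) (avoiding B F)"
  proof (rule inj_onI)
    fix x y assume xy: "x \<in> avoiding B F" "y \<in> avoiding B F" "block_map M x = block_map M y"
    show "x = y"
    proof (cases x)
      case (FinSeq u)
      then obtain v where "y = FinSeq v"
        using xy(3) by (cases y) auto
      then show ?thesis
        using FinSeq_only_empty xy(1,2) FinSeq by metis
    next
      case (InfSeq f)
      then obtain g where g: "y = InfSeq g"
        using xy(3) by (cases y) auto
      then have "block_code (Suc M) f i = block_code (Suc M) g i" for i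
        using xy(3) InfSeq by simp
      \<comment> \<open>The first letter of the window at \<open>i\<close> is the entry at
        \<open>i\<close>.\<close>
      then have "f i = g i" for i
        unfolding block_code_eq_iff by (metis add.right_neutral zero_less_Suc)
      then show ?thesis
        using InfSeq g by auto
    qed
  qed
next
  have "block_map M x \<in> edge_shift_of G" if "x \<in> avoiding B F" for x
  proof (cases x)
    case (FinSeq u)
    then show ?thesis
      using that FinSeq_only_empty Nil_edge_shift_G by auto
  next
    case (InfSeq f)
    then show ?thesis
      using that by (auto simp: InfSeq_edge_shift_G infinite_paths_G InfSeq_avoiding_iff)
  qed
  moreover have "y \<in> block_map M ` avoiding B F" if y: "y \<in> edge_shift_of G" for y
  proof (cases y)
    case (FinSeq u)
    then have "u = []"
      using y FinSeq_edge_shift_G_empty by simp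
    then have "FinSeq [] \<in> avoiding B F" "y = block_map M (FinSeq [])"
      using y FinSeq Nil_edge_shift_G by auto
    then show ?thesis
      by blast
  next
    case (InfSeq e)
    then obtain f where "InfSeq f \<in> V" "e = block_code (Suc M) f"
      using y by (auto simp: InfSeq_edge_shift_G infinite_paths_G)
    then have "InfSeq f \<in> avoiding B F" "y = block_map M (InfSeq f)"
      using InfSeq by (simp_all add: InfSeq_avoiding_iff)
    then show ?thesis
      by blast
  qed
  ultimately show "block_map M ` avoiding B F = edge_shift_of G"
    by blast
qed

lemma avoiding_InfSeq_if_entry:
  assumes "x \<in> avoiding B F" "entry x 0 = Some a"
  obtains g where "x = InfSeq g" "InfSeq g \<in> V"
  using assms FinSeq_only_empty by (cases x) (auto simp: InfSeq_avoiding_iff split: if_splits)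

text \<open>Continuity is checked pointwise: at an infinite sequence because each edge depends on a
  window of fixed length, at the empty sequence because a finite set of edges has finitely many
  first letters.\<close>

lemma continuous_map_block_map:
  "continuous_map (subtopology (full_shift B) (avoiding B F))
     (subtopology (full_shift (arcs G)) (edge_shift_of G)) (block_map M)"
proof -
  let ?Y = "avoiding B F"
  have top: "topspace (subtopology (full_shift B) ?Y) = ?Y"
    using avoiding_subset_topspace by (auto simp: topspace_subtopology)
  have im: "block_map M x \<in> edge_shift_of G" if "x \<in> ?Y" for x
    using bij_betw_block_map that by (auto simp: bij_betw_def)
  have sub: "edge_shift_of G \<subseteq> topspace (full_shift (arcs G))"
    by (simp add: edge_shift_of_eq_avoiding avoiding_subset_topspace)
  have nbhd: "\<exists>T. openin (full_shift B) T \<and> x \<in> T \<and> (\<forall>y \<in> T \<inter> ?Y. block_map M y \<in> U)"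
    if U: "openin (full_shift (arcs G)) U" and x: "x \<in> ?Y" "block_map M x \<in> U" for U x
  proof (cases x)
    case (FinSeq u)
    then have u: "x = FinSeq []"
      using x FinSeq_only_empty by simp
    then obtain K where K: "finite K" "gen_cylinder (arcs G) [] K \<subseteq> U"
      using full_shift_nbhd_FinSeq[OF U] x(2) by auto
    \<comment> \<open>An image can start with an edge in \<open>K\<close> only if the sequence
      starts with the first letter of that edge.\<close>
    let ?T = "gen_cylinder B [] ((\<lambda>e. hd (from_nat e)) ` K)"
    have "block_map M y \<in> U" if y: "y \<in> ?T \<inter> ?Y" for y
    proof (cases y)
      case (FinSeq v)
      then show ?thesis
        using x(2) u by simp
    next
      case (InfSeq g)
      then have "g 0 \<notin> (\<lambda>e. hd (from_nat e)) ` K"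
        using y by (auto simp: gen_cylinder_def)
      moreover have "hd (from_nat (block_code (Suc M) g 0)) = g 0"
        by (simp add: upt_rec)
      ultimately have "block_code (Suc M) g 0 \<notin> K"
        by (metis imageI)
      then have "block_map M y \<in> gen_cylinder (arcs G) [] K"
        using im[of y] y sub InfSeq by (auto simp: gen_cylinder_def)
      then show ?thesis
        using K(2) by blast
    qed
    moreover have "x \<in> ?T"
      using x(1) avoiding_subset_topspace by (auto simp: gen_cylinder_def u)
    ultimately show ?thesis
      using openin_gen_cylinder[of "(\<lambda>e. hd (from_nat e)) ` K" B "[]"] K(1) by blast
  next
    case (InfSeq f)
    then have "InfSeq (block_code (Suc M) f) \<in> U"
      using x(2) by simp
    then obtain n where n: "\<And>z. \<lbrakk>z \<in> topspace (full_shift (arcs G));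
        \<And>i. i < n \<Longrightarrow> entry z i = Some (block_code (Suc M) f i)\<rbrakk> \<Longrightarrow> z \<in> U"
      using full_shift_nbhd_InfSeq[OF U] by metis
    \<comment> \<open>Windows starting before \<open>n\<close> lie below \<open>n + M\<close>. The
      additional entry keeps the prefix nonempty even for \<open>n = 0\<close> and
      \<open>M = 0\<close>, which excludes the empty sequence from the cylinder.\<close>
    let ?T = "gen_cylinder B (map f [0..<n + Suc M]) {}"
    have "block_map M y \<in> U" if y: "y \<in> ?T \<inter> ?Y" for y
    proof -
      have ent: "entry y i = Some (f i)" if "i < n + Suc M" for i
        using y that by (auto simp: gen_cylinder_def simp del: upt_Suc)
      obtain g where g: "y = InfSeq g"
        using avoiding_InfSeq_if_entry[of y "f 0"] y ent[of 0] by auto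
      have "block_code (Suc M) g i = block_code (Suc M) f i" if "i < n" for i
        using ent that by (simp add: g block_code_eq_iff)
      then show ?thesis
        using n[of "block_map M y"] im[of y] y sub g by auto
    qed
    moreover have "x \<in> ?T"
      using x(1) avoiding_subset_topspace by (auto simp: gen_cylinder_def InfSeq simp del: upt_Suc)
    ultimately show ?thesis
      using openin_gen_cylinder[OF finite.emptyI, of B "map f [0..<n + Suc M]"] by blast
  qed
  have "openin (subtopology (full_shift B) ?Y) {x \<in> ?Y. block_map M x \<in> U}"
    if U: "openin (full_shift (arcs G)) U" for U
  proof (subst openin_subopen, intro ballI)
    fix x assume "x \<in> {x \<in> ?Y. block_map M x \<in> U}"
    then obtain T where T: "openin (full_shift B) T" "x \<in> T" "\<forall>y \<in> T \<inter> ?Y. block_map M y \<in> U" "x \<in> ?Y"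
      using nbhd[OF U] by blast
    then show "\<exists>T. openin (subtopology (full_shift B) ?Y) T \<and> x \<in> T \<and> T \<subseteq> {x \<in> ?Y. block_map M x \<in> U}"
      by (intro exI[of _ "T \<inter> ?Y"]) (auto simp: openin_subtopology)
  qed
  then have "continuous_map (subtopology (full_shift B) ?Y) (full_shift (arcs G)) (block_map M)"
    using im sub unfolding continuous_map_def top by blast
  then show ?thesis
    using im top by (auto simp: continuous_map_in_subtopology)
qed

lemma conjugacy_block_map: "conjugacy B (avoiding B F) (arcs G) (edge_shift_of G) (block_map M)"
proof -
  have "block_map M (shift x) = shift (block_map M x)" for x :: "'a seqn"
    using block_code_shift[of "Suc M" _ 1] by (cases x) auto
  moreover have "seqn_length (block_map M x) = seqn_length x" if "x \<in> avoiding B F" for x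
    using that FinSeq_only_empty by (cases x) auto
  ultimately show ?thesis
    by (simp add: conjugacy_def shift_morphism_def bij_betw_block_map continuous_map_block_map)
qed

end

section \<open>Transport along conjugacies and the use of row-finiteness\<close>

lemma conjugacy_compose:
  assumes \<phi>: "conjugacy A X B Y \<phi>" and \<psi>: "conjugacy B Y C Z \<psi>"
  shows "conjugacy A X C Z (\<psi> \<circ> \<phi>)"
proof -
  have "\<phi> x \<in> Y" if "x \<in> X" for x
    using \<phi> that by (auto simp: conjugacy_def bij_betw_def)
  then show ?thesis
    using \<phi> \<psi> unfolding conjugacy_def shift_morphism_def
    by (auto intro: continuous_map_compose bij_betw_trans)
qed

lemma prepend_append: "prepend (u @ v) x = prepend u (prepend v x)"
  by (cases x) simp_all

text \<open>By the infinite-extension property infinitely many letters can follow a finite point,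
  hence also its last letter if it has one, against row-finiteness.\<close>

lemma row_finite_FinSeq_empty:
  assumes X: "shift_space A X" and "row_finite A X" and u: "FinSeq u \<in> X"
  shows "u = []"
proof (rule ccontr)
  assume "u \<noteq> []"
  let ?S = "{a \<in> A. \<exists>y \<in> topspace (full_shift A). prepend (u @ [a]) y \<in> X}"
  have "FinSeq u \<in> topspace (full_shift A)"
    using X u closedin_subset by (auto simp: shift_space_def)
  then have "last u \<in> A"
    using \<open>u \<noteq> []\<close> by (auto simp: topspace_full_shift fin_seqs_def inf_seqs_def split: if_splits)
  have "[last u, a] \<in> blocks X" if "prepend (u @ [a]) y \<in> X" for a y
  proof -
    have "u @ [a] = butlast u @ [last u, a]"
      using \<open>u \<noteq> []\<close> by (cases u rule: rev_cases) simp_all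
    then have "prepend (u @ [a]) y = prepend (butlast u) (prepend [last u, a] y)"
      by (simp only: prepend_append)
    then show ?thesis
      using that unfolding blocks_def subblock_def by blast
  qed
  then have "?S \<subseteq> {b \<in> A. [last u, b] \<in> blocks X}"
    by auto
  moreover have "infinite ?S"
    using X u by (simp add: shift_space_def)
  moreover have "finite {b \<in> A. [last u, b] \<in> blocks X}"
    using \<open>row_finite A X\<close> \<open>last u \<in> A\<close> by (simp add: row_finite_def)
  ultimately show False
    using finite_subset by blast
qed

text \<open>What is transported to \<open>Y\<close> is not row-finiteness but the absence of
  nonempty finite sequences: \<open>\<phi>\<close> is onto and preserves length. The block map on
  \<open>Y\<close> then completes the conjugacy.\<close>

lemma conjugate_to_step_imp_edge_shift:
  assumes X: "shift_space A X" "row_finite A X" and "conjugate_to_step M A X"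
  shows "edge_shift A X"
proof -
  obtain B :: "nat set" and Y \<phi> F where \<phi>: "conjugacy A X B Y \<phi>"
    and F: "\<forall>u\<in>F. length u = M + 1" and Y: "Y = avoiding B F"
    using assms(3) by (auto simp: conjugate_to_step_def conjugate_def step_shift_space_def)
  have "u = []" if u: "FinSeq u \<in> Y" for u
  proof -
    obtain x where x: "x \<in> X" "\<phi> x = FinSeq u"
      using \<phi> u by (metis bij_betw_def conjugacy_def imageE)
    then have "seqn_length x = enat (length u)"
      using \<phi> by (metis conjugacy_def seqn_length.simps(1) shift_morphism_def)
    then show ?thesis
      using x(1) row_finite_FinSeq_empty[OF X] by (cases x) fastforce+
  qed
  then interpret higher_block B F M
    using F Y by unfold_locales auto
  have "conjugacy A X (arcs G) (edge_shift_of G) (block_map M \<circ> \<phi>)"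
    using conjugacy_compose[OF \<phi>] conjugacy_block_map Y by simp
  then show ?thesis
    using X(1) countable_digraph_G not_sink_G unfolding edge_shift_def conjugate_def by blast
qed

theorem proposition6p7:
  fixes A :: "'a set" and X :: "'a seqn set"
  assumes "shift_space A X" and "row_finite A X"
  shows "(edge_shift A X \<longleftrightarrow> conjugate_to_step 1 A X) \<and>
         (conjugate_to_step 1 A X \<longleftrightarrow> (\<exists>M\<ge>1. conjugate_to_step M A X))"
  \<comment> \<open>Every \<open>M\<close>-step case passes through the edge shift to reach the
    1-step case.\<close>
  using edge_shift_imp_conjugate_to_1_step conjugate_to_step_imp_edge_shift[OF assms] by blast

end
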